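(* Let $d=4$ and let $h,g$ be distinct $4$-uniform hypergraphs on the same vertex set with $\mathrm{Proj}(h)=\mathrm{Proj}(g)$ and $e(h)\ge e(g)$. Then $d-1-\frac{1}{m(h)}\ge\frac{2d-4}{2d-1}=\frac47$.
   Context: $\mathrm{Proj}(H)$ is the graph on the vertex set of $H$ with $\{i,j\}$ an edge iff some hyperedge contains $\{i,j\}$. $e(\cdot)$ and $v(\cdot)$ are numbers of hyperedges and vertices; $m(H)=\max_{K\subseteq H} e(K)/v(K)$ over subhypergraphs $K$ of $H$. *)

theory Defs
  imports Complex_Main
begin

record 'a hypergraph =
  verts :: "'a set"
  edges :: "'a set set"

definition hypergraph :: "'a hypergraph \<Rightarrow> bool" where
  "hypergraph H \<longleftrightarrow> finite (verts H) \<and> (\<forall>A\<in>edges H. A \<subseteq> verts H)"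

definition uniform_hypergraph :: "nat \<Rightarrow> 'a hypergraph \<Rightarrow> bool" where
  "uniform_hypergraph d H \<longleftrightarrow> hypergraph H \<and> (\<forall>A\<in>edges H. card A = d)"

definition num_verts :: "'a hypergraph \<Rightarrow> nat" where
  "num_verts H = card (verts H)"

definition num_edges :: "'a hypergraph \<Rightarrow> nat" where
  "num_edges H = card (edges H)"

definition subhypergraph :: "'a hypergraph \<Rightarrow> 'a hypergraph \<Rightarrow> bool" where
  "subhypergraph K H \<longleftrightarrow> hypergraph K \<and> verts K \<subseteq> verts H \<and> edges K \<subseteq> edges H"

text \<open>A graph is represented as a hypergraph whose edges are two-element sets.\<close>

definition Proj :: "'a hypergraph \<Rightarrow> 'a hypergraph" where
  "Proj H = \<lparr>verts = verts H,
     edges = {{i, j} | i j. i \<noteq> j \<and> (\<exists>A\<in>edges H. {i, j} \<subseteq> A)}\<rparr>"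

text \<open>The maximum ranges over subhypergraphs with at least one vertex, so that the quotient
  is meaningful. For a hypergraph with a nonempty vertex set the set below is finite
  and nonempty.\<close>

definition max_density :: "'a hypergraph \<Rightarrow> real" where
  "max_density H =
     Max {real (num_edges K) / real (num_verts K) | K. subhypergraph K H \<and> verts K \<noteq> {}}"

end

theory Submission
  imports Defs
begin

text \<open>
  Let \<open>D\<close> consist of the hyperedges of \<open>h\<close> outside \<open>g\<close>, let \<open>N\<close> be the common hyperedges, and let
  \<open>E\<close> consist of those hyperedges of \<open>g\<close> outside \<open>h\<close> that meet a member of \<open>D\<close> in at least two
  vertices; then \<open>|E| \<le> |D|\<close>. Put \<open>W = \<Union>(D \<union> E)\<close>. Adding to \<open>D\<close> all \<open>C \<in> N\<close> with
  \<open>k = |C \<inter> W| \<ge> 2\<close> gives a subhypergraph with \<open>17 e - 7 v \<ge> 17 |D| - 7 |W| + \<Sum> (17 - 7 (4 - k))\<close>.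
  This is nonnegative by discharging: measured in eighths, every member of \<open>D \<union> E\<close> distributes 68
  among its vertices (half of \<open>8 \<cdot> 17\<close>, since \<open>|E| \<le> |D|\<close> lets \<open>D\<close> pay for \<open>E\<close>), every \<open>C \<in> N\<close> pays its
  vertices in \<open>W\<close>, and each vertex of \<open>W\<close> receives at least \<open>8 \<cdot> 7 = 56\<close>. The last point holds because
  \<open>D \<union> N\<close> and \<open>E \<union> N\<close> cover the same pairs at a vertex, so a pair covered by only one of \<open>D\<close> and
  \<open>E\<close> is also covered by \<open>N\<close>. If some \<open>A \<in> D\<close> meets no member of \<open>E\<close> in two vertices, then all
  its pairs are covered by \<open>N\<close> and \<open>W = A\<close> already works.
\<close>

section \<open>Shares, weights and loads for the discharging\<close>

definition deg :: "'a set set \<Rightarrow> 'a \<Rightarrow> nat" where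
  "deg F v = card {X \<in> F. v \<in> X}"

text \<open>A vertex in a single member of \<open>F\<close> may receive as little as 36 from the common hyperedges,
  hence the 20; the remaining vertices of \<open>X\<close> make up for it, so that the total stays 68.\<close>

definition share :: "'a set set \<Rightarrow> 'a set \<Rightarrow> 'a \<Rightarrow> nat" where
  "share F X v = (if deg F v = 1 then 20
     else let s = card {u \<in> X. deg F u = 1} in if s = 0 then 17 else if s = 1 then 16 else 14)"

text \<open>The weights satisfy \<open>k * weight k \<le> 8 * (17 - 7 * (4 - k))\<close> for \<open>k \<in> {2, 3, 4}\<close>.\<close>

definition weight :: "nat \<Rightarrow> nat" where
  "weight k = (if k = 2 then 12 else if k = 3 then 24 else if k = 4 then 34 else 0)"

definition load :: "'a set set \<Rightarrow> 'a set \<Rightarrow> 'a \<Rightarrow> nat" where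
  "load N W v = (\<Sum>C | C \<in> N \<and> v \<in> C. weight (card (C \<inter> W)))"

lemma share_ge: "14 \<le> share F X v"
  by (simp add: share_def Let_def)

lemma sum_share:
  assumes "card X = 4" "card {u \<in> X. deg F u = 1} \<le> 2"
  shows "(\<Sum>v\<in>X. share F X v) = 68"
proof -
  let ?S = "{u \<in> X. deg F u = 1}"
  have fin: "finite X" using assms(1) by (metis card.infinite zero_neq_numeral)
  have "(\<Sum>v\<in>X. share F X v) = (\<Sum>v\<in>?S. share F X v) + (\<Sum>v\<in>X - ?S. share F X v)"
    using fin by (metis (no_types, lifting) add.commute mem_Collect_eq subsetI sum.subset_diff)
  moreover have "(\<Sum>v\<in>?S. share F X v) = 20 * card ?S"
    by (simp add: share_def)
  moreover have "(\<Sum>v\<in>X - ?S. share F X v)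
      = (4 - card ?S) * (if card ?S = 0 then 17 else if card ?S = 1 then 16 else 14)"
  proof -
    have "card (X - ?S) = 4 - card ?S"
      using fin assms(1) by (subst card_Diff_subset) auto
    moreover have "(\<Sum>v\<in>X - ?S. share F X v)
       = (\<Sum>v\<in>X - ?S. if card ?S = 0 then 17 else if card ?S = 1 then 16 else 14)"
      by (rule sum.cong) (auto simp: share_def Let_def)
    ultimately show ?thesis by simp
  qed
  moreover have "card ?S \<in> {0, 1, 2}" using assms(2) by auto
  ultimately show ?thesis by auto
qed

section \<open>Lower bounds for the load at a vertex\<close>

text \<open>Meant for \<open>j = card (C \<inter> T)\<close> and
  \<open>k = card (C \<inter> W)\<close> with \<open>v\<close> in \<open>W\<close> outside
  \<open>T\<close>. Rate 12 fails only for \<open>j = 3\<close>, \<open>k = 4\<close>, where the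
  weight is 34.\<close>

lemma weight_ge:
  assumes "j < k" "k \<le> 4"
  shows "11 * j \<le> weight k" "j \<le> 2 \<Longrightarrow> 12 * j \<le> weight k"
  using assms by (auto simp: weight_def)

text \<open>The members of \<open>N\<close> through \<open>v\<close> cover \<open>T\<close>, so
  their intersections with \<open>T\<close> have total size at least \<open>card T\<close>;
  \<open>c\<close> is the weight collected per vertex of \<open>T\<close>.\<close>

lemma load_ge:
  assumes N: "finite N" and cover: "\<And>u. u \<in> T \<Longrightarrow> \<exists>C\<in>N. v \<in> C \<and> u \<in> C"
    and "finite T"
    and c: "\<And>C. \<lbrakk>C \<in> N; v \<in> C\<rbrakk> \<Longrightarrow> c * card (C \<inter> T) \<le> weight (card (C \<inter> W))"
  shows "c * card T \<le> load N W v"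
proof -
  let ?M = "{C \<in> N. v \<in> C}"
  have "T = (\<Union>C\<in>?M. C \<inter> T)" using cover by fastforce
  then have "card T \<le> (\<Sum>C\<in>?M. card (C \<inter> T))"
    using card_UN_le[of ?M "\<lambda>C. C \<inter> T"] N by simp
  then have "c * card T \<le> (\<Sum>C\<in>?M. c * card (C \<inter> T))"
    by (metis mult_le_mono2 sum_distrib_left)
  also have "\<dots> \<le> load N W v"
    unfolding load_def using c by (intro sum_mono) auto
  finally show ?thesis .
qed

text \<open>The vertex \<open>v\<close> lies in \<open>C \<inter> W\<close> but not in
  \<open>C \<inter> T\<close>, which gives the strict inequality that \<open>weight_ge\<close> asks
  for.\<close>

lemma
  assumes N: "finite N" "\<And>C. C \<in> N \<Longrightarrow> card C = 4"
    and cover: "\<And>u. u \<in> T \<Longrightarrow> \<exists>C\<in>N. v \<in> C \<and> u \<in> C"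
    and T: "finite T" "T \<subseteq> W" "v \<in> W" "v \<notin> T"
  shows load_ge_11: "11 * card T \<le> load N W v"
    and load_ge_12: "(\<And>C. \<lbrakk>C \<in> N; v \<in> C\<rbrakk> \<Longrightarrow> card (C \<inter> T) \<le> 2) \<Longrightarrow> 12 * card T \<le> load N W v"
proof -
  have "card (C \<inter> T) < card (C \<inter> W) \<and> card (C \<inter> W) \<le> 4" if "C \<in> N" "v \<in> C" for C
  proof -
    have "finite C" using N(2)[OF that(1)] by (metis card.infinite zero_neq_numeral)
    then show ?thesis
      using T that N(2)[OF that(1)]
      by (metis Int_iff Int_lower1 Int_mono card_mono finite_Int order_refl psubsetI psubset_card_mono)
  qed
  then have *: "11 * card (C \<inter> T) \<le> weight (card (C \<inter> W))"
      "card (C \<inter> T) \<le> 2 \<Longrightarrow> 12 * card (C \<inter> T) \<le> weight (card (C \<inter> W))"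
    if "C \<in> N" "v \<in> C" for C
    using weight_ge that by blast+
  show "11 * card T \<le> load N W v"
    using * by (intro load_ge[OF N(1) cover T(1)]) auto
  show "12 * card T \<le> load N W v"
    if "\<And>C. \<lbrakk>C \<in> N; v \<in> C\<rbrakk> \<Longrightarrow> card (C \<inter> T) \<le> 2"
    using * that by (intro load_ge[OF N(1) cover T(1)]) auto
qed

lemma card_eq_imp_eq:
  assumes "card X = 4" "card Y = 4" "X \<subseteq> Y"
  shows "X = Y"
  using assms by (metis card.infinite card_subset_eq zero_neq_numeral)

text \<open>A member of \<open>N\<close> containing all of \<open>A\<close> would equal
  \<open>A\<close>. So those through \<open>v\<close> meet \<open>A - {v}\<close> in at most two
  vertices, and rate 12 applies to all three vertices of \<open>A - {v}\<close>.\<close>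

lemma load_isolated:
  assumes N: "finite N" "\<And>C. C \<in> N \<Longrightarrow> card C = 4"
    and A: "card A = 4" "A \<notin> N" "A \<subseteq> W" "v \<in> A"
    and cover: "\<And>u. \<lbrakk>u \<in> A; u \<noteq> v\<rbrakk> \<Longrightarrow> \<exists>C\<in>N. v \<in> C \<and> u \<in> C"
  shows "36 \<le> load N W v"
proof -
  have fin: "finite A" using A(1) by (metis card.infinite zero_neq_numeral)
  then have three: "card (A - {v}) = 3" using A by simp
  have "card (C \<inter> (A - {v})) \<le> 2" if C: "C \<in> N" "v \<in> C" for C
  proof (rule ccontr)
    assume "\<not> ?thesis"
    moreover have "C \<inter> (A - {v}) \<subseteq> A - {v}" by blast
    ultimately have "C \<inter> (A - {v}) = A - {v}"
      using three fin by (metis card_seteq finite_Diff not_less_eq_eq numeral_2_eq_2 numeral_3_eq_3)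
    then have "A \<subseteq> C" using C by blast
    then have "A = C" using card_eq_imp_eq A N(2) C by metis
    then show False using A C by simp
  qed
  then have "12 * card (A - {v}) \<le> load N W v"
    using A fin cover by (intro load_ge_12 N) auto
  then show ?thesis using three by simp
qed

section \<open>The discharging argument\<close>

text \<open>The hypotheses are symmetric in \<open>D\<close> and \<open>E\<close>, so facts proved
  for \<open>D\<close> carry over to \<open>E\<close> through \<open>flip\<close>. The bound
  \<open>card E \<le> card D\<close> enters only after \<open>total_charge\<close>.\<close>

locale exchange =
  fixes D E N :: "'a set set"
  assumes fin: "finite D" "finite E" "finite N"
    and card_D: "A \<in> D \<Longrightarrow> card A = 4" and card_E: "A \<in> E \<Longrightarrow> card A = 4"
    and card_N: "A \<in> N \<Longrightarrow> card A = 4"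
    and disj: "D \<inter> E = {}" "D \<inter> N = {}" "E \<inter> N = {}"
    and cover_D: "\<lbrakk>A \<in> D; u \<in> A; v \<in> A; u \<noteq> v\<rbrakk> \<Longrightarrow> \<exists>Y\<in>E \<union> N. u \<in> Y \<and> v \<in> Y"
    and cover_E: "\<lbrakk>A \<in> E; u \<in> A; v \<in> A; u \<noteq> v\<rbrakk> \<Longrightarrow> \<exists>Y\<in>D \<union> N. u \<in> Y \<and> v \<in> Y"
    and meet_D: "A \<in> D \<Longrightarrow> \<exists>B\<in>E. 2 \<le> card (A \<inter> B)"
    and meet_E: "A \<in> E \<Longrightarrow> \<exists>B\<in>D. 2 \<le> card (A \<inter> B)"
begin

abbreviation "F \<equiv> D \<union> E"
abbreviation "W \<equiv> \<Union>F"

lemma flip: "exchange E D N"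
  using fin card_D card_E card_N disj cover_D cover_E meet_D meet_E
  by unfold_locales auto

lemma finite_edge: "X \<in> F \<Longrightarrow> finite X"
  using card_D card_E by (metis UnE card.infinite zero_neq_numeral)

lemma finite_W: "finite W"
  using fin finite_edge by auto

lemma deg_split: "deg F v = card {A \<in> D. v \<in> A} + card {B \<in> E. v \<in> B}"
proof -
  have "{X \<in> F. v \<in> X} = {A \<in> D. v \<in> A} \<union> {B \<in> E. v \<in> B}" by auto
  then show ?thesis
    unfolding deg_def using fin disj by (simp add: card_Un_disjoint disjoint_iff)
qed

lemma deg_ge_2:
  assumes "A \<in> D" "B \<in> E" "v \<in> A" "v \<in> B"
  shows "2 \<le> deg F v"
proof -
  have "card {A \<in> D. v \<in> A} \<noteq> 0" "card {B \<in> E. v \<in> B} \<noteq> 0"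
    using assms fin by auto
  then show ?thesis by (simp add: deg_split)
qed

text \<open>Vertices of \<open>A \<inter> B\<close> have degree at least 2, so those of degree one
  lie in the rest of \<open>A\<close>. With \<open>meet_D\<close> at most two remain, as
  \<open>sum_share\<close> requires.\<close>

lemma deficient_D:
  assumes "A \<in> D" "B \<in> E"
  shows "card {u \<in> A. deg F u = 1} + card (A \<inter> B) \<le> 4"
proof -
  have "{u \<in> A. deg F u = 1} \<inter> (A \<inter> B) = {}"
    using deg_ge_2[OF assms] by force
  moreover have f: "finite A" using finite_edge assms by blast
  ultimately have "card {u \<in> A. deg F u = 1} + card (A \<inter> B)
      = card ({u \<in> A. deg F u = 1} \<union> (A \<inter> B))"
    by (simp add: card_Un_disjoint)
  also have "\<dots> \<le> card A" using f by (intro card_mono) auto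
  finally show ?thesis using card_D[OF assms(1)] by simp
qed

lemma sum_share_D:
  assumes "A \<in> D"
  shows "(\<Sum>v\<in>A. share F A v) = 68"
proof -
  obtain B where "B \<in> E" "2 \<le> card (A \<inter> B)" using meet_D assms by blast
  with deficient_D[OF assms] have "card {u \<in> A. deg F u = 1} \<le> 2" by fastforce
  then show ?thesis using sum_share card_D assms by blast
qed

lemma charge_D:
  assumes v: "v \<in> W" and le: "card {B \<in> E. v \<in> B} \<le> card {A \<in> D. v \<in> A}"
  shows "56 \<le> (\<Sum>X | X \<in> F \<and> v \<in> X. share F X v) + load N W v"
proof -
  define P where "P = {A \<in> D. v \<in> A}"
  define Q where "Q = {B \<in> E. v \<in> B}"
  let ?S = "(\<Sum>X\<in>P. share F X v) + (\<Sum>X\<in>Q. share F X v)"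
  have finPQ: "finite P" "finite Q" using fin by (auto simp: P_def Q_def)
  have PQ: "{X. X \<in> F \<and> v \<in> X} = P \<union> Q" "P \<inter> Q = {}" using disj by (auto simp: P_def Q_def)
  have S: "(\<Sum>X | X \<in> F \<and> v \<in> X. share F X v) = ?S"
    unfolding PQ(1) using finPQ PQ(2) by (rule sum.union_disjoint)
  have le: "card Q \<le> card P" using le by (simp add: P_def Q_def)
  have deg: "deg F v = card P + card Q" by (simp add: deg_split P_def Q_def)
  have "P \<union> Q \<noteq> {}" using v by (auto simp: P_def Q_def)
  then have "P \<noteq> {}" using le finPQ by auto
  then have P0: "card P \<noteq> 0" using finPQ by simp
  have sP: "14 * card P \<le> (\<Sum>X\<in>P. share F X v)" and sQ: "14 * card Q \<le> (\<Sum>X\<in>Q. share F X v)"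
    using sum_bounded_below[of P 14 "\<lambda>X. share F X v"] sum_bounded_below[of Q 14 "\<lambda>X. share F X v"]
    by (simp_all add: share_ge mult.commute)
  \<comment> \<open>These are the \<open>u\<close> whose pair with \<open>v\<close> is covered by
    exactly one of \<open>D\<close> and \<open>E\<close>; the cover hypotheses then force
    \<open>N\<close> to cover it.\<close>
  define T where "T = (\<Union>P - \<Union>Q) \<union> (\<Union>Q - \<Union>P) - {v}"
  have T: "T \<subseteq> W" "v \<notin> T" by (auto simp: T_def P_def Q_def)
  have finT: "finite T" using T(1) finite_W by (rule finite_subset)
  have cov: "\<exists>C\<in>N. v \<in> C \<and> u \<in> C" if u: "u \<in> T" for u
  proof -
    consider "u \<in> \<Union>P - \<Union>Q" | "u \<in> \<Union>Q - \<Union>P" using u by (auto simp: T_def)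
    then show ?thesis
    proof cases
      case 1
      then obtain A where "A \<in> D" "v \<in> A" "u \<in> A" by (auto simp: P_def)
      then obtain Y where "Y \<in> E \<union> N" "u \<in> Y" "v \<in> Y" using cover_D T(2) u by metis
      then show ?thesis using 1 by (auto simp: Q_def)
    next
      case 2
      then obtain A where "A \<in> E" "v \<in> A" "u \<in> A" by (auto simp: Q_def)
      then obtain Y where "Y \<in> D \<union> N" "u \<in> Y" "v \<in> Y" using cover_E T(2) u by metis
      then show ?thesis using 2 by (auto simp: P_def)
    qed
  qed
  have l11: "11 * card T \<le> load N W v"
    using load_ge_11[OF fin(3) card_N cov finT T(1) v T(2)] by simp
  have l12: "12 * card T \<le> load N W v" if "card T \<le> 2"
  proof (rule load_ge_12[OF fin(3) card_N cov finT T(1) v T(2)])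
    show "card (C \<inter> T) \<le> 2" for C
      using that finT by (meson Int_lower2 card_mono le_trans)
  qed simp_all
  have c4: "card X = 4" "finite X" "v \<in> X" if "X \<in> P \<or> X \<in> Q" for X
    using that card_D card_E finite_edge by (auto simp: P_def Q_def)
  \<comment> \<open>Exhaustive because \<open>P\<close> is nonempty and
    \<open>card Q \<le> card P\<close>. In the first case four shares of 14 already give 56.\<close>
  consider "card P + card Q \<ge> 4" | "card P = 1" "card Q = 0"
    | "card P \<ge> 2" "card Q = 0" | "card P = 1" "card Q = 1" | "card P = 2" "card Q = 1"
    using P0 le by linarith
  then have "56 \<le> ?S + load N W v"
  proof cases
    case 1
    then show ?thesis using sP sQ by linarith
  next
    case 2
    then obtain A where A: "P = {A}" and Q: "Q = {}"
      using finPQ by (metis card_0_eq card_1_singletonE)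
    have AD: "A \<in> D" "v \<in> A" using A by (auto simp: P_def)
    \<comment> \<open>The only share is 20, so exactly 36 must come from \<open>N\<close>.\<close>
    have "36 \<le> load N W v"
    proof (rule load_isolated[OF fin(3) card_N card_D[OF AD(1)]])
      show "A \<notin> N" using disj AD by blast
      show "\<exists>C\<in>N. v \<in> C \<and> u \<in> C" if "u \<in> A" "u \<noteq> v" for u
        using that by (intro cov) (auto simp: T_def A Q)
    qed (use AD in auto)
    moreover have "?S = 20" using deg 2 by (simp add: A Q share_def)
    ultimately show ?thesis by simp
  next
    case 3
    then have Q: "Q = {}" using finPQ by simp
    obtain A where A: "A \<in> P" using P0 by fastforce
    have "card (A - {v}) \<le> card T"
      using A Q by (intro card_mono finT) (auto simp: T_def)
    \<comment> \<open>Two shares of at least 14 and a load of 33 suffice.\<close>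
    then have "3 \<le> card T" using c4[of A] A by simp
    then show ?thesis using l11 sP 3 by linarith
  next
    case 4
    then obtain A B where A: "P = {A}" and B: "Q = {B}" by (metis card_1_singletonE)
    have AD: "A \<in> D" "B \<in> E" "v \<in> A" "v \<in> B" using A B by (auto simp: P_def Q_def)
    have neq: "A \<noteq> B" using AD disj by blast
    have cA: "card A = 4" "card B = 4" and f: "finite A" "finite B" using c4 A B by auto
    have T: "T = (A - B) \<union> (B - A)" using AD by (auto simp: T_def A B)
    have cT: "card T = card (A - B) + card (B - A)"
      unfolding T using f by (intro card_Un_disjoint) auto
    have d: "card (A - B) = 4 - card (A \<inter> B)" "card (B - A) = 4 - card (A \<inter> B)"
      using f cA by (simp_all add: card_Diff_subset_Int Int_commute)
    have "card (A \<inter> B) < 4"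
    proof (rule ccontr)
      assume "\<not> ?thesis"
      then have "card (A - B) = 0" using d by simp
      then have "A \<subseteq> B" using f by simp
      then show False using card_eq_imp_eq cA neq by blast
    qed
    then consider "card (A \<inter> B) = 3" | "card (A \<inter> B) \<le> 2" by linarith
    then show ?thesis
    proof cases
      case 1
      interpret flip: exchange E D N by (rule flip)
      \<comment> \<open>Both shares are at least 16, and the two vertices of \<open>T\<close> yield
        24: the total 56 is attained with no slack.\<close>
      have "card {u \<in> A. deg F u = 1} \<le> 1" "card {u \<in> B. deg F u = 1} \<le> 1"
        using deficient_D[OF AD(1,2)] flip.deficient_D[OF AD(2,1)] 1
        by (simp_all add: Int_commute Un_commute)
      moreover have "deg F v \<noteq> 1" using deg 4 by simp
      ultimately have "16 \<le> share F A v" "16 \<le> share F B v"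
        by (auto simp: share_def Let_def)
      then have "32 \<le> ?S" by (simp add: A B)
      moreover have "24 \<le> load N W v" using l12 cT d 1 by simp
      ultimately show ?thesis by linarith
    next
      case 2
      then have "4 \<le> card T" using cT d by linarith
      then show ?thesis using l11 sP sQ 4 by linarith
    qed
  next
    case 5
    then obtain B where B: "Q = {B}" by (metis card_1_singletonE)
    obtain A where A: "A \<in> P" using P0 by fastforce
    have "A \<noteq> B" using A B PQ by blast
    then have "\<not> A \<subseteq> B" using card_eq_imp_eq[of A B] c4(1)[of A] c4(1)[of B] A B by auto
    then obtain x where x: "x \<in> A" "x \<notin> B" by blast
    then have xT: "x \<in> T" using A B c4 by (auto simp: T_def)
    consider "2 \<le> card T" | "card T = 1"
      using xT finT by (metis card_gt_0_iff empty_iff less_one linorder_not_le nat_less_le not_less_eq_eq numeral_2_eq_2 One_nat_def)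
    then show ?thesis
    proof cases
      case 1
      then show ?thesis using l11 sP sQ 5 by linarith
    next
      case 2
      then have "T = {x}" using xT by (metis card_1_singletonE singletonD)
      \<comment> \<open>As \<open>x\<close> is outside \<open>B\<close>, no vertex of
        \<open>B\<close> can lie outside \<open>\<Union>P\<close>. So \<open>B\<close> has no vertex
        of degree one and gives 17, for a total of at least 28 + 17 + 12.\<close>
      then have sub: "B \<subseteq> \<Union>P"
        using x A B c4 by (auto simp: T_def)
      have "{u \<in> B. deg F u = 1} = {}"
      proof -
        have "deg F u \<noteq> 1" if u: "u \<in> B" for u
        proof -
          obtain A' where "A' \<in> D" "u \<in> A'" using sub u unfolding P_def by blast
          moreover have "B \<in> E" using B by (auto simp: Q_def)
          ultimately show ?thesis using deg_ge_2[of A' B u] u by simp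
        qed
        then show ?thesis by blast
      qed
      moreover have "deg F v \<noteq> 1" using deg 5 by simp
      ultimately have "share F B v = 17"
        by (simp only: share_def Let_def card.empty simp_thms if_True if_False)
      then show ?thesis using sP 5 l12 2 B by simp
    qed
  qed
  then show ?thesis using S by simp
qed

lemma charge:
  assumes "v \<in> W"
  shows "56 \<le> (\<Sum>X | X \<in> F \<and> v \<in> X. share F X v) + load N W v"
proof (cases "card {B \<in> E. v \<in> B} \<le> card {A \<in> D. v \<in> A}")
  case True
  then show ?thesis using charge_D assms by blast
next
  case False
  interpret flip: exchange E D N by (rule flip)
  have c: "E \<union> D = F" by blast
  show ?thesis using flip.charge_D[unfolded c] assms False by simp
qed

text \<open>Sum \<open>charge\<close> over \<open>W\<close> and exchange the sums: each member of
  \<open>F\<close> hands out 68.\<close>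

lemma total_charge:
  "56 * card W \<le> 68 * (card D + card E) + (\<Sum>v\<in>W. load N W v)"
proof -
  interpret flip: exchange E D N by (rule flip)
  have c: "E \<union> D = F" by blast
  have "(\<Sum>v\<in>W. \<Sum>X | X \<in> F \<and> v \<in> X. share F X v)
      = (\<Sum>X\<in>F. \<Sum>v | v \<in> W \<and> v \<in> X. share F X v)"
    using finite_W fin by (intro sum.swap_restrict) auto
  also have "\<dots> = (\<Sum>X\<in>F. 68)"
  proof (rule sum.cong)
    fix X assume X: "X \<in> F"
    then have "{v. v \<in> W \<and> v \<in> X} = X" by blast
    then show "(\<Sum>v | v \<in> W \<and> v \<in> X. share F X v) = 68"
      using X sum_share_D flip.sum_share_D[unfolded c] by auto
  qed simp
  also have "\<dots> = 68 * (card D + card E)"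
    using fin disj by (simp add: card_Un_disjoint)
  finally have "(\<Sum>v\<in>W. \<Sum>X | X \<in> F \<and> v \<in> X. share F X v) = 68 * (card D + card E)" .
  moreover have "(\<Sum>v\<in>W. 56) \<le> (\<Sum>v\<in>W. (\<Sum>X | X \<in> F \<and> v \<in> X. share F X v) + load N W v)"
    by (rule sum_mono) (rule charge)
  ultimately show ?thesis by (simp add: sum.distrib mult.commute)
qed

end

section \<open>From the charge inequality to a dense family\<close>

lemma sum_load:
  assumes "finite N" "finite W"
  shows "(\<Sum>v\<in>W. load N W v) = (\<Sum>C\<in>N. card (C \<inter> W) * weight (card (C \<inter> W)))"
proof -
  have "(\<Sum>v\<in>W. load N W v) = (\<Sum>C\<in>N. \<Sum>v | v \<in> W \<and> v \<in> C. weight (card (C \<inter> W)))"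
    unfolding load_def using assms by (intro sum.swap_restrict)
  moreover have "{v. v \<in> W \<and> v \<in> C} = C \<inter> W" for C by blast
  ultimately show ?thesis by simp
qed

text \<open>In eighths, an edge is worth 136 and a vertex costs 56. An edge with
  \<open>k \<ge> 2\<close> vertices in \<open>W\<close> can pay these and cover its
  \<open>4 - k\<close> outside vertices; the others pay nothing and are left out.\<close>

lemma weight_le:
  assumes "k \<le> 4"
  shows "k * weight k + 56 * (4 - k) \<le> 136 \<or> k < 2 \<and> weight k = 0"
  using assms by (auto simp: weight_def)

lemma dense_subfamily:
  assumes fin: "finite D" "finite N" "finite W" and disj: "D \<inter> N = {}"
    and D: "\<And>A. A \<in> D \<Longrightarrow> A \<subseteq> W" and N: "\<And>C. C \<in> N \<Longrightarrow> card C = 4"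
    and charge: "56 * card W \<le> 136 * card D + (\<Sum>v\<in>W. load N W v)"
  obtains S where "S \<subseteq> D \<union> N" "7 * card (W \<union> \<Union>S) \<le> 17 * card S"
proof
  let ?M = "{C \<in> N. 2 \<le> card (C \<inter> W)}"
  let ?S = "D \<union> ?M"
  let ?k = "\<lambda>C. card (C \<inter> W)"
  show "?S \<subseteq> D \<union> N" by blast
  have finC: "finite C" if "C \<in> N" for C
    using N[OF that] by (metis card.infinite zero_neq_numeral)
  have k4: "?k C \<le> 4" if "C \<in> N" for C
    using N[OF that] finC[OF that] by (metis Int_lower1 card_mono)
  have "W \<union> \<Union>?S = W \<union> (\<Union>C\<in>?M. C - W)" using D by blast
  then have "card (W \<union> \<Union>?S) \<le> card W + card (\<Union>C\<in>?M. C - W)"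
    by (simp only: card_Un_le)
  also have "card (\<Union>C\<in>?M. C - W) \<le> (\<Sum>C\<in>?M. card (C - W))"
    using fin by (intro card_UN_le) simp
  also have "\<dots> = (\<Sum>C\<in>?M. 4 - ?k C)"
    using finC N by (intro sum.cong) (auto simp: card_Diff_subset_Int)
  finally have "56 * card (W \<union> \<Union>?S) \<le> 56 * card W + 56 * (\<Sum>C\<in>?M. 4 - ?k C)"
    by simp
  also have "\<dots> \<le> 136 * card D + (\<Sum>C\<in>N. ?k C * weight (?k C)) + 56 * (\<Sum>C\<in>?M. 4 - ?k C)"
    using charge sum_load[of N W] fin by simp
  \<comment> \<open>Members outside \<open>?M\<close> have weight 0.\<close>
  also have "(\<Sum>C\<in>N. ?k C * weight (?k C)) = (\<Sum>C\<in>?M. ?k C * weight (?k C))"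
    using fin by (intro sum.mono_neutral_right) (auto simp: weight_def)
  also have "136 * card D + (\<Sum>C\<in>?M. ?k C * weight (?k C)) + 56 * (\<Sum>C\<in>?M. 4 - ?k C)
      = 136 * card D + (\<Sum>C\<in>?M. ?k C * weight (?k C) + 56 * (4 - ?k C))"
    by (simp add: sum.distrib sum_distrib_left)
  also have "(\<Sum>C\<in>?M. ?k C * weight (?k C) + 56 * (4 - ?k C)) \<le> (\<Sum>C\<in>?M. 136)"
    by (rule sum_mono) (use k4 weight_le in fastforce)
  also have "136 * card D + (\<Sum>C\<in>?M. 136) = 136 * card ?S"
    using fin disj by (subst card_Un_disjoint) auto
  finally show "7 * card (W \<union> \<Union>?S) \<le> 17 * card ?S" by simp
qed

section \<open>Hypergraphs with the same projection\<close>

lemma Proj_edge_iff: "{u, v} \<in> edges (Proj H) \<longleftrightarrow> u \<noteq> v \<and> (\<exists>A\<in>edges H. u \<in> A \<and> v \<in> A)"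
  unfolding Proj_def by (auto simp: doubleton_eq_iff)

lemma Proj_cover:
  assumes "Proj h = Proj g" "A \<in> edges h" "u \<in> A" "v \<in> A" "u \<noteq> v"
  shows "\<exists>B\<in>edges g. u \<in> B \<and> v \<in> B"
  using assms Proj_edge_iff[of u v h] Proj_edge_iff[of u v g] by auto

lemma two_le_cardI:
  assumes "finite X" "u \<in> X" "v \<in> X" "u \<noteq> v"
  shows "2 \<le> card X"
  using assms card_mono[of X "{u, v}"] by simp

text \<open>The set \<open>U\<close> is kept apart from \<open>\<Union>S\<close> because it is built
  from \<open>W\<close>, which may contain vertices of \<open>E\<close> that lie in no member of
  \<open>S\<close>.\<close>

lemma same_Proj_dense:
  fixes h g :: "'a hypergraph"
  assumes h: "uniform_hypergraph 4 h" and g: "uniform_hypergraph 4 g"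
    and "verts h = verts g" "h \<noteq> g" and P: "Proj h = Proj g" and "num_edges g \<le> num_edges h"
  obtains S U where "S \<subseteq> edges h" "U \<subseteq> verts h" "U \<noteq> {}" "\<Union>S \<subseteq> U" "7 * card U \<le> 17 * card S"
proof -
  define D where "D = edges h - edges g"
  define N where "N = edges h \<inter> edges g"
  define E where "E = {B \<in> edges g - edges h. \<exists>A\<in>D. 2 \<le> card (B \<inter> A)}"
  have V: "finite (verts h)" "finite (verts g)"
    and sub: "\<And>A. A \<in> edges h \<Longrightarrow> A \<subseteq> verts h" "\<And>A. A \<in> edges g \<Longrightarrow> A \<subseteq> verts h"
    and c4: "\<And>A. A \<in> edges h \<Longrightarrow> card A = 4" "\<And>A. A \<in> edges g \<Longrightarrow> card A = 4"
    using h g assms(3) by (auto simp: uniform_hypergraph_def hypergraph_def)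
  have finE: "finite (edges h)" "finite (edges g)"
    using sub V by (meson Pow_iff finite_Pow_iff finite_subset subsetI)+
  have fin: "finite D" "finite E" "finite N" using finE by (auto simp: D_def E_def N_def)
  have finA: "finite A" if "A \<in> edges h" for A
    using sub V that finite_subset by metis
  have neq: "edges h \<noteq> edges g" using assms(3,4) by (cases h; cases g) auto
  have "card (edges g) \<le> card (edges h)" using assms(6) by (simp add: num_edges_def)
  \<comment> \<open>Otherwise \<open>edges h\<close> is contained in \<open>edges g\<close> and,
    being at least as large, equal to it.\<close>
  then have "D \<noteq> {}"
    using neq finE by (metis D_def Diff_eq_empty_iff card_seteq)
  have card_le: "card E \<le> card D"
  proof -
    have "card E \<le> card (edges g - edges h)"
      using finE by (intro card_mono) (auto simp: E_def)
    moreover have "card (edges g - edges h) = card (edges g) - card N"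
      using finE by (simp add: N_def card_Diff_subset_Int Int_commute)
    moreover have "card D = card (edges h) - card N"
      using finE by (simp add: N_def D_def card_Diff_subset_Int)
    ultimately show ?thesis using \<open>card (edges g) \<le> card (edges h)\<close> by linarith
  qed
  have cover_D: "\<exists>Y\<in>E \<union> N. u \<in> Y \<and> v \<in> Y" if *: "A \<in> D" "u \<in> A" "v \<in> A" "u \<noteq> v" for A u v
  proof -
    obtain Y where Y: "Y \<in> edges g" "u \<in> Y" "v \<in> Y"
      using Proj_cover[OF P, of A u v] * by (auto simp: D_def)
    \<comment> \<open>This puts \<open>Y\<close> into \<open>E\<close> if it is not an edge of
      \<open>h\<close>.\<close>
    have "2 \<le> card (Y \<inter> A)"
      using * Y finA by (intro two_le_cardI[of _ u v]) (auto simp: D_def)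
    then show ?thesis using Y * by (auto simp: E_def N_def)
  qed
  have N4: "card C = 4" if "C \<in> N" for C using c4 that by (auto simp: N_def)
  have "\<exists>S W. W \<noteq> {} \<and> W \<subseteq> verts h \<and> S \<subseteq> D \<union> N \<and> 7 * card (W \<union> \<Union>S) \<le> 17 * card S"
  proof (cases "\<forall>A\<in>D. \<exists>B\<in>E. 2 \<le> card (A \<inter> B)")
    case True
    interpret exchange D E N
    proof
      fix A u v assume "A \<in> E" "u \<in> A" "v \<in> A" "u \<noteq> v"
      then show "\<exists>Y\<in>D \<union> N. u \<in> Y \<and> v \<in> Y"
        using Proj_cover[OF P[symmetric], of A u v] by (auto simp: D_def E_def N_def)
    qed (use fin c4 cover_D True in \<open>auto simp: D_def E_def N_def\<close>)
    \<comment> \<open>Each member of \<open>D\<close> pays 68 twice, once on behalf of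
      \<open>E\<close>.\<close>
    have "68 * (card D + card E) \<le> 136 * card D" using card_le by simp
    then have "56 * card W \<le> 136 * card D + (\<Sum>v\<in>W. load N W v)"
      using total_charge by (meson add_right_mono le_trans)
    then obtain S where "S \<subseteq> D \<union> N" "7 * card (W \<union> \<Union>S) \<le> 17 * card S"
      using dense_subfamily[OF fin(1,3) finite_W disj(2) _ card_N] by blast
    moreover have "W \<subseteq> verts h" using sub by (auto simp: D_def E_def)
    moreover have "W \<noteq> {}" using \<open>D \<noteq> {}\<close> card_D by fastforce
    ultimately show ?thesis by (intro exI[of _ S] exI[of _ W] conjI)
  next
    case False
    then obtain A where A: "A \<in> D" and no: "\<And>B. B \<in> E \<Longrightarrow> \<not> 2 \<le> card (A \<inter> B)" by blast
    have A4: "card A = 4" and fA: "finite A" using c4 A finA by (auto simp: D_def)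
    have "36 \<le> load N A v" if v: "v \<in> A" for v
    proof (rule load_isolated[OF fin(3) N4 A4])
      show "\<exists>C\<in>N. v \<in> C \<and> u \<in> C" if u: "u \<in> A" "u \<noteq> v" for u
      proof -
        obtain Y where Y: "Y \<in> E \<union> N" "u \<in> Y" "v \<in> Y" using cover_D A u v by metis
        then have "2 \<le> card (A \<inter> Y)"
          using u v fA by (intro two_le_cardI[of _ u v]) auto
        then show ?thesis using Y no by blast
      qed
    qed (use A v in \<open>auto simp: D_def N_def\<close>)
    then have "(\<Sum>v\<in>A. 36) \<le> (\<Sum>v\<in>A. load N A v)" by (intro sum_mono)
    \<comment> \<open>Numerically 224 against 136 + 4 * 36 = 280, with \<open>{A}\<close> in the
      role of \<open>D\<close>.\<close>
    then have "56 * card A \<le> 136 * card {A} + (\<Sum>v\<in>A. load N A v)"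
      using A4 by simp
    moreover have "{A} \<inter> N = {}" using A by (auto simp: D_def N_def)
    ultimately obtain S where "S \<subseteq> {A} \<union> N" "7 * card (A \<union> \<Union>S) \<le> 17 * card S"
      using dense_subfamily[of "{A}" N A] fA fin N4 by blast
    moreover from this have "S \<subseteq> D \<union> N" using A by blast
    moreover have "A \<subseteq> verts h" "A \<noteq> {}" using A sub A4 by (auto simp: D_def)
    ultimately show ?thesis by (intro exI[of _ S] exI[of _ A] conjI)
  qed
  then obtain S W where "W \<noteq> {}" "W \<subseteq> verts h" "S \<subseteq> D \<union> N" "7 * card (W \<union> \<Union>S) \<le> 17 * card S"
    by blast
  moreover from this have "S \<subseteq> edges h" by (auto simp: D_def N_def)
  moreover from this have "\<Union>S \<subseteq> verts h" using sub by blast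
  ultimately show ?thesis using that[of S "W \<union> \<Union>S"] by blast
qed

section \<open>Maximum density and the conclusion\<close>

text \<open>The \<open>Max\<close> is over a finite set, since a subhypergraph is determined by a
  subset of the vertices and a subset of the edges.\<close>

lemma max_density_ge:
  fixes H :: "'a hypergraph"
  assumes "hypergraph H" "subhypergraph K H" "verts K \<noteq> {}"
  shows "real (num_edges K) / real (num_verts K) \<le> max_density H"
proof -
  have "finite (edges H)"
    using assms(1) by (meson Pow_iff finite_Pow_iff finite_subset hypergraph_def subsetI)
  then have "finite ((\<lambda>(V, E). \<lparr>verts = V, edges = E\<rparr>) ` (Pow (verts H) \<times> Pow (edges H)))"
    using assms(1) by (simp add: hypergraph_def)
  moreover have "{K. subhypergraph K H \<and> verts K \<noteq> {}}
      \<subseteq> (\<lambda>(V, E). \<lparr>verts = V, edges = E\<rparr>) ` (Pow (verts H) \<times> Pow (edges H))"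
  proof
    fix K assume "K \<in> {K. subhypergraph K H \<and> verts K \<noteq> {}}"
    then show "K \<in> (\<lambda>(V, E). \<lparr>verts = V, edges = E\<rparr>) ` (Pow (verts H) \<times> Pow (edges H))"
      by (intro image_eqI[of _ _ "(verts K, edges K)"]) (auto simp: subhypergraph_def)
  qed
  ultimately have "finite {K. subhypergraph K H \<and> verts K \<noteq> {}}" by (rule rev_finite_subset)
  then show ?thesis
    unfolding max_density_def using assms by (intro Max_ge) auto
qed

theorem theorem35:
  fixes d :: nat and h g :: "'a hypergraph"
  assumes "d = 4"
    and "uniform_hypergraph d h" and "uniform_hypergraph d g"
    and "verts h = verts g" and "h \<noteq> g"
    and "Proj h = Proj g"
    and "num_edges h \<ge> num_edges g"
  shows "real d - 1 - 1 / max_density h \<ge> (2 * real d - 4) / (2 * real d - 1) \<and>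
         (2 * real d - 4) / (2 * real d - 1) = 4 / 7"
proof -
  obtain S U where S: "S \<subseteq> edges h" "U \<subseteq> verts h" "U \<noteq> {}" "\<Union>S \<subseteq> U" "7 * card U \<le> 17 * card S"
    using same_Proj_dense[of h g] assms by metis
  let ?K = "\<lparr>verts = U, edges = S\<rparr>"
  have h: "hypergraph h" using assms(2) by (simp add: uniform_hypergraph_def)
  then have U: "finite U" using S(2) finite_subset by (auto simp: hypergraph_def)
  then have "subhypergraph ?K h" using S by (auto simp: subhypergraph_def hypergraph_def)
  then have "real (card S) / real (card U) \<le> max_density h"
    using max_density_ge[OF h, of ?K] S(3) by (simp add: num_edges_def num_verts_def)
  moreover have "7 / 17 \<le> real (card S) / real (card U)"
  proof -
    have "0 < card U" using U S(3) by (simp add: card_gt_0_iff)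
    then show ?thesis using S(5) by (simp add: field_simps)
  qed
  ultimately have "7 / 17 \<le> max_density h" by linarith
  \<comment> \<open>The bound 17/7 is what is needed, as 3 - 17/7 = 4/7.\<close>
  then have "1 / max_density h \<le> 17 / 7" by (simp add: field_simps)
  then show ?thesis using assms(1) by simp
qed

end
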